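(* For any CS-interpretation $^*$ whose verification predicate satisfies conditions (V1)–(V3) below, if $F$ is a theorem of $\mathsf{LPV}\text{-}\mathcal{CS}$ then it is provably valid under the constant specification $\mathcal{CS}$: \[ \mathsf{LPV}\text{-}\mathcal{CS} \vdash F \ \Rightarrow \ \mathsf{PA} \vdash F^*. \]
   Context: The language of $\mathsf{LPV^-}$ is classical propositional logic extended with a verification operator ${\bf V}$ and proof terms built from proof variables and proof constants by binary application $\cdot$, binary plus $+$ and unary proof checker $!$; formulas include ${\bf V}A$ and $t{:}A$. $\mathsf{LPV^-}$ has axioms: classical propositional tautologies; $t{:}(A\to B)\to(s{:}A\to (t\cdot s){:}B)$; $t{:}A\to A$; $t{:}A\to\, !t{:}t{:}A$; $t{:}A\to (s+t){:}A$ and $t{:}A\to(t+s){:}A$; ${\bf V}(A\to B)\to({\bf V}A\to{\bf V}B)$; $t{:}A\to{\bf V}A$; rules: Modus Ponens and Axiom Necessitation (from an axiom $A$ infer $c{:}A$ for a proof constant $c$). $\mathsf{LPV}$ is $\mathsf{LPV^-}$ plus the axiom $\neg t{:}{\bf V}\bot$. A constant specification $\mathcal{CS}$ is a set of formulas $c_i{:}A_i$ with $A_i$ an axiom and $c_i$ a proof constant; $\mathsf{LPV}\text{-}\mathcal{CS}$ is $\mathsf{LPV}$ without Axiom Necessitation but with the members of $\mathcal{CS}$ as extra axioms. A normal proof predicate is a provably $\Delta$ arithmetical formula $\mathsf{Prf}(x,y)$ such that for every arithmetical sentence $F$: $\mathsf{PA}\vdash F$ iff $\mathsf{Prf}(n,F)$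 holds for some $n$; each $k$ proves only finitely many formulas; and for any $k,l$ there is $n$ proving everything $k$ and $l$ prove. For such a predicate there are recursive functions $\mathsf{m},\mathsf{a},\mathsf{c}$ with $(\mathsf{Prf}(k,F\to G)\land\mathsf{Prf}(n,F))\to\mathsf{Prf}(\mathsf{m}(k,n),G)$, $\mathsf{Prf}(k,F)\to\mathsf{Prf}(\mathsf{a}(k,n),F)$, $\mathsf{Prf}(n,F)\to\mathsf{Prf}(\mathsf{a}(k,n),F)$, and $\mathsf{Prf}(k,F)\to\mathsf{Prf}(\mathsf{c}(k),\mathsf{Prf}(k,F))$. A verification predicate for $\mathsf{LPV}$ is a provably $\Sigma$ formula $\mathsf{Ver}(x)$ such that for all arithmetical formulas $F,G$: (V1) $\mathsf{PA}\vdash \mathsf{Ver}(F\to G)\to(\mathsf{Ver}(F)\to\mathsf{Ver}(G))$; (V2) for each $n$, $\mathsf{PA}\vdash\mathsf{Prf}(n,F)\to\mathsf{Ver}(F)$; (V3) for any $n$, $\mathsf{PA}\vdash\neg\mathsf{Prf}(n,\mathsf{Ver}(\bot))$. An arithmetical interpretation $^*$ consists of a normal proof predicate $\mathsf{Prf}$ with $\mathsf{m},\mathsf{a},\mathsf{c}$, a verification predicate $\mathsf{Ver}$, an evaluation of propositional letters by $\mathsf{PA}$ sentences and of proof variables and constants by natural numbers, extended by: $\bot^*=\bot$, $^*$ commutes with $\land,\lor,\to$, $(t\cdot s)^*=\mathsf{m}(t^*,s^* )$, $(t+s)^*=\mathsf{a}(t^*,s^* )$, $(!t)^*=\mathsf{c}(t^*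 )$, $(t{:}F)^*=\mathsf{Prf}(t^*,F^* )$, $({\bf V}F)^*=\mathsf{Ver}(F^* )$. A CS-interpretation is an interpretation under which all formulas of $\mathcal{CS}^*$ are true; $F$ is provably valid under $\mathcal{CS}$ if $\mathsf{PA}\vdash F^*$ for every CS-interpretation $^*$. *)

theory Defs
  imports Main "HOL-Library.Nat_Bijection"
begin

section \<open>First-order Peano arithmetic\<close>

text \<open>Variables are de Bruijn indices: under a quantifier, index \<open>0\<close> is the bound variable and
  \<open>Suc n\<close> is the variable \<open>n\<close> of the surrounding context.\<close>

datatype atm =
    AVar nat
  | AZero
  | ASucc atm
  | APlus atm atm
  | ATimes atm atm

datatype afm =
    AEq atm atm
  | AFalse
  | AConj afm afm
  | ADisj afm afm
  | AImp afm afm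
  | AAll afm
  | AEx afm

abbreviation ANeg :: "afm \<Rightarrow> afm" where
  "ANeg A \<equiv> AImp A AFalse"

abbreviation AIff :: "afm \<Rightarrow> afm \<Rightarrow> afm" where
  "AIff A B \<equiv> AConj (AImp A B) (AImp B A)"

primrec num :: "nat \<Rightarrow> atm" where
  "num 0 = AZero"
| "num (Suc n) = ASucc (num n)"

primrec fv_tm :: "atm \<Rightarrow> nat set" where
  "fv_tm (AVar n) = {n}"
| "fv_tm AZero = {}"
| "fv_tm (ASucc t) = fv_tm t"
| "fv_tm (APlus s t) = fv_tm s \<union> fv_tm t"
| "fv_tm (ATimes s t) = fv_tm s \<union> fv_tm t"

primrec fv :: "afm \<Rightarrow> nat set" where
  "fv (AEq s t) = fv_tm s \<union> fv_tm t"
| "fv AFalse = {}"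
| "fv (AConj A B) = fv A \<union> fv B"
| "fv (ADisj A B) = fv A \<union> fv B"
| "fv (AImp A B) = fv A \<union> fv B"
| "fv (AAll A) = {n. Suc n \<in> fv A}"
| "fv (AEx A) = {n. Suc n \<in> fv A}"

definition sentence :: "afm \<Rightarrow> bool" where
  "sentence A \<longleftrightarrow> fv A = {}"

primrec subst_tm :: "(nat \<Rightarrow> atm) \<Rightarrow> atm \<Rightarrow> atm" where
  "subst_tm \<sigma> (AVar n) = \<sigma> n"
| "subst_tm \<sigma> AZero = AZero"
| "subst_tm \<sigma> (ASucc t) = ASucc (subst_tm \<sigma> t)"
| "subst_tm \<sigma> (APlus s t) = APlus (subst_tm \<sigma> s) (subst_tm \<sigma> t)"
| "subst_tm \<sigma> (ATimes s t) = ATimes (subst_tm \<sigma> s) (subst_tm \<sigma> t)"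

definition lift_tm :: "atm \<Rightarrow> atm" where
  "lift_tm = subst_tm (\<lambda>n. AVar (Suc n))"

definition under :: "(nat \<Rightarrow> atm) \<Rightarrow> nat \<Rightarrow> atm" where
  "under \<sigma> = case_nat (AVar 0) (\<lambda>n. lift_tm (\<sigma> n))"

primrec subst :: "(nat \<Rightarrow> atm) \<Rightarrow> afm \<Rightarrow> afm" where
  "subst \<sigma> (AEq s t) = AEq (subst_tm \<sigma> s) (subst_tm \<sigma> t)"
| "subst \<sigma> AFalse = AFalse"
| "subst \<sigma> (AConj A B) = AConj (subst \<sigma> A) (subst \<sigma> B)"
| "subst \<sigma> (ADisj A B) = ADisj (subst \<sigma> A) (subst \<sigma> B)"
| "subst \<sigma> (AImp A B) = AImp (subst \<sigma> A) (subst \<sigma> B)"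
| "subst \<sigma> (AAll A) = AAll (subst (under \<sigma>) A)"
| "subst \<sigma> (AEx A) = AEx (subst (under \<sigma>) A)"

definition lift :: "afm \<Rightarrow> afm" where
  "lift = subst (\<lambda>n. AVar (Suc n))"

text \<open>\<open>inst A t\<close> puts \<open>t\<close> for variable \<open>0\<close> and lowers all other variables by one, so it is the
  instance of \<open>AAll A\<close> at \<open>t\<close>.\<close>

definition inst :: "afm \<Rightarrow> atm \<Rightarrow> afm" where
  "inst A t = subst (case_nat t AVar) A"

primrec val_tm :: "(nat \<Rightarrow> nat) \<Rightarrow> atm \<Rightarrow> nat" where
  "val_tm e (AVar n) = e n"
| "val_tm e AZero = 0"
| "val_tm e (ASucc t) = Suc (val_tm e t)"
| "val_tm e (APlus s t) = val_tm e s + val_tm e t"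
| "val_tm e (ATimes s t) = val_tm e s * val_tm e t"

primrec sat :: "(nat \<Rightarrow> nat) \<Rightarrow> afm \<Rightarrow> bool" where
  "sat e (AEq s t) \<longleftrightarrow> val_tm e s = val_tm e t"
| "sat e AFalse \<longleftrightarrow> False"
| "sat e (AConj A B) \<longleftrightarrow> sat e A \<and> sat e B"
| "sat e (ADisj A B) \<longleftrightarrow> sat e A \<or> sat e B"
| "sat e (AImp A B) \<longleftrightarrow> (sat e A \<longrightarrow> sat e B)"
| "sat e (AAll A) \<longleftrightarrow> (\<forall>n. sat (case_nat n e) A)"
| "sat e (AEx A) \<longleftrightarrow> (\<exists>n. sat (case_nat n e) A)"

definition true_arith :: "afm \<Rightarrow> bool" where
  "true_arith A \<longleftrightarrow> (\<forall>e. sat e A)"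

text \<open>Propositional tautologies: equations and quantified formulas count as atoms.\<close>

primrec aprop :: "(afm \<Rightarrow> bool) \<Rightarrow> afm \<Rightarrow> bool" where
  "aprop v (AEq s t) \<longleftrightarrow> v (AEq s t)"
| "aprop v AFalse \<longleftrightarrow> False"
| "aprop v (AConj A B) \<longleftrightarrow> aprop v A \<and> aprop v B"
| "aprop v (ADisj A B) \<longleftrightarrow> aprop v A \<or> aprop v B"
| "aprop v (AImp A B) \<longleftrightarrow> (aprop v A \<longrightarrow> aprop v B)"
| "aprop v (AAll A) \<longleftrightarrow> v (AAll A)"
| "aprop v (AEx A) \<longleftrightarrow> v (AEx A)"

definition ataut :: "afm \<Rightarrow> bool" where
  "ataut A \<longleftrightarrow> (\<forall>v. aprop v A)"

text \<open>A Hilbert calculus for classical first-order logic with equality together with the axioms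
  of Peano arithmetic. The latter are given in open form; generalization yields their closures.
  In \<open>Ind\<close>, variable \<open>0\<close> of \<open>A\<close> is the induction variable and its other variables are parameters;
  the inner substitution produces \<open>A(Suc x)\<close> in the scope of the quantifier over \<open>x\<close>.\<close>

inductive PA :: "afm \<Rightarrow> bool" (\<open>PA\<turnstile> _\<close> [55] 55) where
  Taut: "ataut A \<Longrightarrow> PA\<turnstile> A"
| AllE: "PA\<turnstile> AImp (AAll A) (inst A t)"
| AllImp: "PA\<turnstile> AImp (AAll (AImp A B)) (AImp (AAll A) (AAll B))"
| AllVac: "PA\<turnstile> AImp A (AAll (lift A))"
| ExI: "PA\<turnstile> AImp (inst A t) (AEx A)"
| ExE: "PA\<turnstile> AImp (AAll (AImp A (lift B))) (AImp (AEx A) B)"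
| EqRefl: "PA\<turnstile> AEq t t"
| EqSubst: "PA\<turnstile> AImp (AEq s t) (AImp (inst A s) (inst A t))"
| SuccNotZero: "PA\<turnstile> ANeg (AEq (ASucc (AVar 0)) AZero)"
| SuccInj: "PA\<turnstile> AImp (AEq (ASucc (AVar 0)) (ASucc (AVar 1))) (AEq (AVar 0) (AVar 1))"
| PlusZero: "PA\<turnstile> AEq (APlus (AVar 0) AZero) (AVar 0)"
| PlusSucc: "PA\<turnstile> AEq (APlus (AVar 0) (ASucc (AVar 1))) (ASucc (APlus (AVar 0) (AVar 1)))"
| TimesZero: "PA\<turnstile> AEq (ATimes (AVar 0) AZero) AZero"
| TimesSucc:
    "PA\<turnstile> AEq (ATimes (AVar 0) (ASucc (AVar 1))) (APlus (ATimes (AVar 0) (AVar 1)) (AVar 0))"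
| Ind: "PA\<turnstile> AImp (inst A AZero)
           (AImp (AAll (AImp A (subst (case_nat (ASucc (AVar 0)) (\<lambda>n. AVar (Suc n))) A)))
                 (AAll A))"
| MP: "PA\<turnstile> AImp A B \<Longrightarrow> PA\<turnstile> A \<Longrightarrow> PA\<turnstile> B"
| Gen: "PA\<turnstile> A \<Longrightarrow> PA\<turnstile> AAll A"

section \<open>The arithmetical hierarchy\<close>

definition ALess :: "atm \<Rightarrow> atm \<Rightarrow> afm" where
  "ALess s t = AEx (AEq (APlus (lift_tm s) (ASucc (AVar 0))) (lift_tm t))"

text \<open>Lifting the bound \<open>t\<close> keeps the quantified variable from occurring in it.\<close>

inductive bounded_fm :: "afm \<Rightarrow> bool" where
  "bounded_fm (AEq s t)"
| "bounded_fm AFalse"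
| "bounded_fm A \<Longrightarrow> bounded_fm B \<Longrightarrow> bounded_fm (AConj A B)"
| "bounded_fm A \<Longrightarrow> bounded_fm B \<Longrightarrow> bounded_fm (ADisj A B)"
| "bounded_fm A \<Longrightarrow> bounded_fm B \<Longrightarrow> bounded_fm (AImp A B)"
| "bounded_fm A \<Longrightarrow> bounded_fm (AAll (AImp (ALess (AVar 0) (lift_tm t)) A))"
| "bounded_fm A \<Longrightarrow> bounded_fm (AEx (AConj (ALess (AVar 0) (lift_tm t)) A))"

inductive sigma_fm :: "afm \<Rightarrow> bool" where
  "bounded_fm A \<Longrightarrow> sigma_fm A"
| "sigma_fm A \<Longrightarrow> sigma_fm (AEx A)"

definition provably_sigma :: "afm \<Rightarrow> bool" where
  "provably_sigma A \<longleftrightarrow> (\<exists>B. sigma_fm B \<and> PA\<turnstile> AIff A B)"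

definition provably_delta :: "afm \<Rightarrow> bool" where
  "provably_delta A \<longleftrightarrow> provably_sigma A \<and> provably_sigma (ANeg A)"

section \<open>Goedel numbering\<close>

primrec gn_tm :: "atm \<Rightarrow> nat" where
  "gn_tm (AVar n) = prod_encode (0, n)"
| "gn_tm AZero = prod_encode (1, 0)"
| "gn_tm (ASucc t) = prod_encode (2, gn_tm t)"
| "gn_tm (APlus s t) = prod_encode (3, prod_encode (gn_tm s, gn_tm t))"
| "gn_tm (ATimes s t) = prod_encode (4, prod_encode (gn_tm s, gn_tm t))"

primrec gn :: "afm \<Rightarrow> nat" where
  "gn (AEq s t) = prod_encode (0, prod_encode (gn_tm s, gn_tm t))"
| "gn AFalse = prod_encode (1, 0)"
| "gn (AConj A B) = prod_encode (2, prod_encode (gn A, gn B))"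
| "gn (ADisj A B) = prod_encode (3, prod_encode (gn A, gn B))"
| "gn (AImp A B) = prod_encode (4, prod_encode (gn A, gn B))"
| "gn (AAll A) = prod_encode (5, gn A)"
| "gn (AEx A) = prod_encode (6, gn A)"

lemma gn_tm_inject: "gn_tm s = gn_tm t \<Longrightarrow> s = t"
proof (induction s arbitrary: t)
  case (AVar n) then show ?case by (cases t) auto
next
  case AZero then show ?case by (cases t) auto
next
  case (ASucc s) then show ?case by (cases t) auto
next
  case (APlus s1 s2) then show ?case by (cases t) auto
next
  case (ATimes s1 s2) then show ?case by (cases t) auto
qed

lemma gn_inject: "gn A = gn B \<Longrightarrow> A = B"
proof (induction A arbitrary: B)
  case (AEq s t) then show ?case by (cases B) (auto dest: gn_tm_inject)
next
  case AFalse then show ?case by (cases B) auto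
next
  case (AConj A1 A2) then show ?case by (cases B) auto
next
  case (ADisj A1 A2) then show ?case by (cases B) auto
next
  case (AImp A1 A2) then show ?case by (cases B) auto
next
  case (AAll A) then show ?case by (cases B) auto
next
  case (AEx A) then show ?case by (cases B) auto
qed

section \<open>Recursive functions\<close>

text \<open>Total recursive functions as the closure of the initial functions under composition,
  primitive recursion and minimization of regular functions. An \<open>n\<close>-ary function takes its
  arguments as a list; only its values on lists of length \<open>n\<close> matter.\<close>

inductive recursive :: "nat \<Rightarrow> (nat list \<Rightarrow> nat) \<Rightarrow> bool" where
  "recursive n (\<lambda>_. 0)"
| "recursive 1 (\<lambda>xs. Suc (xs ! 0))"
| "i < n \<Longrightarrow> recursive n (\<lambda>xs. xs ! i)"
| "recursive (length gs) f \<Longrightarrow> \<forall>g \<in> set gs. recursive n g \<Longrightarrow>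
     recursive n (\<lambda>xs. f (map (\<lambda>g. g xs) gs))"
| "recursive n f \<Longrightarrow> recursive (Suc (Suc n)) g \<Longrightarrow>
     recursive (Suc n) (\<lambda>xs. rec_nat (f (tl xs)) (\<lambda>k r. g (k # r # tl xs)) (hd xs))"
| "recursive (Suc n) f \<Longrightarrow> \<forall>xs. length xs = n \<longrightarrow> (\<exists>y. f (y # xs) = 0) \<Longrightarrow>
     recursive n (\<lambda>xs. LEAST y. f (y # xs) = 0)"

definition recursive1 :: "(nat \<Rightarrow> nat) \<Rightarrow> bool" where
  "recursive1 h \<longleftrightarrow> (\<exists>f. recursive 1 f \<and> (\<forall>k. f [k] = h k))"

definition recursive2 :: "(nat \<Rightarrow> nat \<Rightarrow> nat) \<Rightarrow> bool" where
  "recursive2 h \<longleftrightarrow> (\<exists>f. recursive 2 f \<and> (\<forall>k n. f [k, n] = h k n))"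

section \<open>Proof predicates and verification predicates\<close>

text \<open>In a formula \<open>P\<close> for \<open>Prf(x, y)\<close>, \<open>x\<close> is variable \<open>0\<close> and \<open>y\<close> is variable \<open>1\<close>; in a formula
  \<open>V\<close> for \<open>Ver(x)\<close>, \<open>x\<close> is variable \<open>0\<close>. Numbers and formulas enter through the numerals of their
  values and codes, and \<open>proves P k F\<close> is truth in the standard model.\<close>

definition Prf_of :: "afm \<Rightarrow> nat \<Rightarrow> afm \<Rightarrow> afm" where
  "Prf_of P k F = subst (case_nat (num k) (case_nat (num (gn F)) AVar)) P"

definition Ver_of :: "afm \<Rightarrow> afm \<Rightarrow> afm" where
  "Ver_of V F = inst V (num (gn F))"

abbreviation proves :: "afm \<Rightarrow> nat \<Rightarrow> afm \<Rightarrow> bool" where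
  "proves P k F \<equiv> true_arith (Prf_of P k F)"

definition normal_proof_predicate :: "afm \<Rightarrow> bool" where
  "normal_proof_predicate P \<longleftrightarrow>
     fv P \<subseteq> {0, 1} \<and> provably_delta P \<and>
     (\<forall>F. sentence F \<longrightarrow> (PA\<turnstile> F \<longleftrightarrow> (\<exists>n. proves P n F))) \<and>
     (\<forall>k. finite {F. proves P k F}) \<and>
     (\<forall>k l. \<exists>n. {F. proves P k F} \<union> {F. proves P l F} \<subseteq> {F. proves P n F})"

definition proof_operations ::
  "afm \<Rightarrow> (nat \<Rightarrow> nat \<Rightarrow> nat) \<Rightarrow> (nat \<Rightarrow> nat \<Rightarrow> nat) \<Rightarrow> (nat \<Rightarrow> nat) \<Rightarrow> bool" where
  "proof_operations P m a c \<longleftrightarrow>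
     recursive2 m \<and> recursive2 a \<and> recursive1 c \<and>
     (\<forall>F G. sentence F \<longrightarrow> sentence G \<longrightarrow>
        (\<forall>k n. proves P k (AImp F G) \<and> proves P n F \<longrightarrow> proves P (m k n) G)) \<and>
     (\<forall>F. sentence F \<longrightarrow>
        (\<forall>k n. (proves P k F \<longrightarrow> proves P (a k n) F) \<and> (proves P n F \<longrightarrow> proves P (a k n) F)) \<and>
        (\<forall>k. proves P k F \<longrightarrow> proves P (c k) (Prf_of P k F)))"

definition verification_predicate :: "afm \<Rightarrow> afm \<Rightarrow> bool" where
  "verification_predicate P V \<longleftrightarrow>
     fv V \<subseteq> {0} \<and> provably_sigma V \<and>
     (\<forall>F G. PA\<turnstile> AImp (Ver_of V (AImp F G)) (AImp (Ver_of V F) (Ver_of V G))) \<and>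
     (\<forall>F n. PA\<turnstile> AImp (Prf_of P n F) (Ver_of V F)) \<and>
     (\<forall>n. PA\<turnstile> ANeg (Prf_of P n (Ver_of V AFalse)))"

section \<open>The logic LPV with a constant specification\<close>

datatype ptm =
    PVar nat
  | PConst nat
  | PApp ptm ptm
  | PSum ptm ptm
  | PCheck ptm

datatype fm =
    Letter nat
  | Bot
  | Conj fm fm
  | Disj fm fm
  | Imp fm fm
  | Ver fm
  | Just ptm fm

abbreviation Neg :: "fm \<Rightarrow> fm" where
  "Neg A \<equiv> Imp A Bot"

primrec fprop :: "(fm \<Rightarrow> bool) \<Rightarrow> fm \<Rightarrow> bool" where
  "fprop v (Letter p) \<longleftrightarrow> v (Letter p)"
| "fprop v Bot \<longleftrightarrow> False"
| "fprop v (Conj A B) \<longleftrightarrow> fprop v A \<and> fprop v B"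
| "fprop v (Disj A B) \<longleftrightarrow> fprop v A \<or> fprop v B"
| "fprop v (Imp A B) \<longleftrightarrow> (fprop v A \<longrightarrow> fprop v B)"
| "fprop v (Ver A) \<longleftrightarrow> v (Ver A)"
| "fprop v (Just t A) \<longleftrightarrow> v (Just t A)"

definition tautology :: "fm \<Rightarrow> bool" where
  "tautology A \<longleftrightarrow> (\<forall>v. fprop v A)"

inductive LPV_axiom :: "fm \<Rightarrow> bool" where
  "tautology A \<Longrightarrow> LPV_axiom A"
| "LPV_axiom (Imp (Just t (Imp A B)) (Imp (Just s A) (Just (PApp t s) B)))"
| "LPV_axiom (Imp (Just t A) A)"
| "LPV_axiom (Imp (Just t A) (Just (PCheck t) (Just t A)))"
| "LPV_axiom (Imp (Just t A) (Just (PSum s t) A))"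
| "LPV_axiom (Imp (Just t A) (Just (PSum t s) A))"
| "LPV_axiom (Imp (Ver (Imp A B)) (Imp (Ver A) (Ver B)))"
| "LPV_axiom (Imp (Just t A) (Ver A))"
| "LPV_axiom (Neg (Just t (Ver Bot)))"

definition constant_specification :: "fm set \<Rightarrow> bool" where
  "constant_specification CS \<longleftrightarrow> (\<forall>F \<in> CS. \<exists>i A. F = Just (PConst i) A \<and> LPV_axiom A)"

inductive LPV_CS :: "fm set \<Rightarrow> fm \<Rightarrow> bool" (\<open>LPV-_ \<turnstile> _\<close> [55, 55] 55) for CS where
  "LPV_axiom A \<Longrightarrow> LPV-CS \<turnstile> A"
| "A \<in> CS \<Longrightarrow> LPV-CS \<turnstile> A"
| "LPV-CS \<turnstile> Imp A B \<Longrightarrow> LPV-CS \<turnstile> A \<Longrightarrow> LPV-CS \<turnstile> B"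

section \<open>Arithmetical interpretations\<close>

record interp =
  prf_fm :: afm
  m_fun :: "nat \<Rightarrow> nat \<Rightarrow> nat"
  a_fun :: "nat \<Rightarrow> nat \<Rightarrow> nat"
  c_fun :: "nat \<Rightarrow> nat"
  ver_fm :: afm
  letter_val :: "nat \<Rightarrow> afm"
  pvar_val :: "nat \<Rightarrow> nat"
  pconst_val :: "nat \<Rightarrow> nat"

definition arithmetical_interpretation :: "interp \<Rightarrow> bool" where
  "arithmetical_interpretation I \<longleftrightarrow>
     normal_proof_predicate (prf_fm I) \<and>
     proof_operations (prf_fm I) (m_fun I) (a_fun I) (c_fun I) \<and>
     verification_predicate (prf_fm I) (ver_fm I) \<and>
     (\<forall>p. sentence (letter_val I p))"

primrec tm_interp :: "interp \<Rightarrow> ptm \<Rightarrow> nat" where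
  "tm_interp I (PVar i) = pvar_val I i"
| "tm_interp I (PConst i) = pconst_val I i"
| "tm_interp I (PApp t s) = m_fun I (tm_interp I t) (tm_interp I s)"
| "tm_interp I (PSum t s) = a_fun I (tm_interp I t) (tm_interp I s)"
| "tm_interp I (PCheck t) = c_fun I (tm_interp I t)"

primrec fm_interp :: "interp \<Rightarrow> fm \<Rightarrow> afm" where
  "fm_interp I (Letter p) = letter_val I p"
| "fm_interp I Bot = AFalse"
| "fm_interp I (Conj A B) = AConj (fm_interp I A) (fm_interp I B)"
| "fm_interp I (Disj A B) = ADisj (fm_interp I A) (fm_interp I B)"
| "fm_interp I (Imp A B) = AImp (fm_interp I A) (fm_interp I B)"
| "fm_interp I (Ver A) = Ver_of (ver_fm I) (fm_interp I A)"
| "fm_interp I (Just t A) = Prf_of (prf_fm I) (tm_interp I t) (fm_interp I A)"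

definition CS_interpretation :: "fm set \<Rightarrow> interp \<Rightarrow> bool" where
  "CS_interpretation CS I \<longleftrightarrow>
     arithmetical_interpretation I \<and> (\<forall>F \<in> CS. true_arith (fm_interp I F))"

definition provably_valid :: "fm set \<Rightarrow> fm \<Rightarrow> bool" where
  "provably_valid CS F \<longleftrightarrow> (\<forall>I. CS_interpretation CS I \<longrightarrow> PA\<turnstile> fm_interp I F)"

end

theory Submission
  imports Defs
begin

text \<open>Only the axioms about proof terms need an argument. A provably \<open>\<Delta>\<close> formula is decided by
  \<open>PA\<close> at numerals: \<open>PA\<close> is sound for the standard model, so a true instance of the formula, or of
  its negation, is equivalent to a true \<open>\<Sigma>\<close> instance, and these are provable by
  \<open>\<Sigma>\<close>-completeness. Hence each \<open>t:A\<close> is interpreted by a sentence that is provable if true and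
  refutable otherwise, and the properties of \<open>m\<close>, \<open>a\<close>, \<open>c\<close> in the standard model transfer to \<open>PA\<close>.\<close>

section \<open>Substitution\<close>

lemma under_simps [simp]:
  "under \<sigma> 0 = AVar 0"
  "under \<sigma> (Suc n) = lift_tm (\<sigma> n)"
  by (simp_all add: under_def)

lemma subst_tm_cong:
  "(\<And>n. n \<in> fv_tm t \<Longrightarrow> \<sigma> n = \<tau> n) \<Longrightarrow> subst_tm \<sigma> t = subst_tm \<tau> t"
  by (induction t) auto

lemma subst_cong:
  "(\<And>n. n \<in> fv A \<Longrightarrow> \<sigma> n = \<tau> n) \<Longrightarrow> subst \<sigma> A = subst \<tau> A"
proof (induction A arbitrary: \<sigma> \<tau>)
  case (AEq s t)
  then show ?case by (auto intro: subst_tm_cong)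
next
  case (AConj A B)
  show ?case using AConj.IH[of \<sigma> \<tau>] AConj.prems by simp
next
  case (ADisj A B)
  show ?case using ADisj.IH[of \<sigma> \<tau>] ADisj.prems by simp
next
  case (AImp A B)
  show ?case using AImp.IH[of \<sigma> \<tau>] AImp.prems by simp
next
  case (AAll A)
  have "under \<sigma> n = under \<tau> n" if "n \<in> fv A" for n
    using that AAll.prems by (cases n) auto
  then show ?case using AAll.IH[of "under \<sigma>" "under \<tau>"] by simp
next
  case (AEx A)
  have "under \<sigma> n = under \<tau> n" if "n \<in> fv A" for n
    using that AEx.prems by (cases n) auto
  then show ?case using AEx.IH[of "under \<sigma>" "under \<tau>"] by simp
qed simp

lemma subst_tm_AVar [simp]: "subst_tm AVar t = t"
  by (induction t) auto

lemma under_AVar [simp]: "under AVar = AVar"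
proof
  show "under AVar n = AVar n" for n
    by (cases n) (auto simp: lift_tm_def)
qed

lemma subst_AVar [simp]: "subst AVar A = A"
  by (induction A) auto

lemma subst_tm_comp: "subst_tm \<sigma> (subst_tm \<tau> t) = subst_tm (\<lambda>n. subst_tm \<sigma> (\<tau> n)) t"
  by (induction t) auto

lemma under_comp: "(\<lambda>n. subst_tm (under \<sigma>) (under \<tau> n)) = under (\<lambda>n. subst_tm \<sigma> (\<tau> n))"
proof
  show "subst_tm (under \<sigma>) (under \<tau> n) = under (\<lambda>n. subst_tm \<sigma> (\<tau> n)) n" for n
    by (cases n) (auto simp: lift_tm_def subst_tm_comp)
qed

lemma subst_comp: "subst \<sigma> (subst \<tau> A) = subst (\<lambda>n. subst_tm \<sigma> (\<tau> n)) A"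
  by (induction A arbitrary: \<sigma> \<tau>) (simp_all add: subst_tm_comp under_comp)

lemma subst_tm_lift_tm: "subst_tm \<sigma> (lift_tm t) = subst_tm (\<lambda>n. \<sigma> (Suc n)) t"
  by (simp add: lift_tm_def subst_tm_comp)

lemma subst_lift: "subst \<sigma> (lift A) = subst (\<lambda>n. \<sigma> (Suc n)) A"
  by (simp add: lift_def subst_comp)

lemma lift_tm_subst_tm: "lift_tm (subst_tm \<sigma> t) = subst_tm (\<lambda>n. lift_tm (\<sigma> n)) t"
  by (simp add: lift_tm_def subst_tm_comp)

lemma lift_subst: "lift (subst \<sigma> A) = subst (\<lambda>n. lift_tm (\<sigma> n)) A"
  by (simp add: lift_def lift_tm_def subst_comp)

text \<open>Lifting under the binder is undone by the instantiation, so both steps merge into one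
  simultaneous substitution.\<close>

lemma inst_subst_under: "inst (subst (under \<sigma>) A) t = subst (case_nat t \<sigma>) A"
proof -
  have "subst_tm (case_nat t AVar) (under \<sigma> n) = case_nat t \<sigma> n" for n
    by (cases n) (simp_all add: subst_tm_lift_tm)
  then show ?thesis by (simp add: inst_def subst_comp)
qed

lemma subst_inst: "subst \<sigma> (inst A t) = inst (subst (under \<sigma>) A) (subst_tm \<sigma> t)"
proof -
  have "subst_tm \<sigma> (case_nat t AVar n) = case_nat (subst_tm \<sigma> t) \<sigma> n" for n
    by (cases n) auto
  then show ?thesis
    unfolding inst_subst_under by (simp add: inst_def subst_comp)
qed

lemma inst_lift [simp]: "inst (lift A) t = A"
  by (simp add: inst_def subst_lift)

lemma subst_tm_num [simp]: "subst_tm \<sigma> (num n) = num n"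
  by (induction n) auto

lemma lift_tm_num [simp]: "lift_tm (num n) = num n"
  by (simp add: lift_tm_def)

lemma fv_subst_tm: "fv_tm (subst_tm \<sigma> t) = (\<Union>n\<in>fv_tm t. fv_tm (\<sigma> n))"
  by (induction t) auto

text \<open>Binder step of \<open>fv_subst\<close>, shared by both quantifiers; the assumption is
  the induction hypothesis at \<open>under \<sigma>\<close>.\<close>

lemma fv_subst_under:
  assumes "fv (subst (under \<sigma>) A) = (\<Union>n\<in>fv A. fv_tm (under \<sigma> n))"
  shows "{n. Suc n \<in> fv (subst (under \<sigma>) A)} = (\<Union>n\<in>{n. Suc n \<in> fv A}. fv_tm (\<sigma> n))"
proof -
  have "Suc m \<in> fv_tm (under \<sigma> n) \<longleftrightarrow> (\<exists>k. n = Suc k \<and> m \<in> fv_tm (\<sigma> k))" for m n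
    by (cases n) (auto simp: lift_tm_def fv_subst_tm)
  then show ?thesis unfolding assms by auto
qed

lemma fv_subst: "fv (subst \<sigma> A) = (\<Union>n\<in>fv A. fv_tm (\<sigma> n))"
proof (induction A arbitrary: \<sigma>)
  case (AAll A)
  show ?case using fv_subst_under[OF AAll.IH] by simp
next
  case (AEx A)
  show ?case using fv_subst_under[OF AEx.IH] by simp
qed (auto simp: fv_subst_tm)

lemma fv_tm_num [simp]: "fv_tm (num n) = {}"
  by (induction n) auto

section \<open>Soundness of Peano arithmetic\<close>

lemma val_subst_tm: "val_tm e (subst_tm \<sigma> t) = val_tm (\<lambda>n. val_tm e (\<sigma> n)) t"
  by (induction t) auto

lemma val_under:
  "(\<lambda>k. val_tm (case_nat n e) (under \<sigma> k)) = case_nat n (\<lambda>k. val_tm e (\<sigma> k))"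
proof
  show "val_tm (case_nat n e) (under \<sigma> k) = case_nat n (\<lambda>k. val_tm e (\<sigma> k)) k" for k
    by (cases k) (auto simp: lift_tm_def val_subst_tm)
qed

lemma sat_subst: "sat e (subst \<sigma> A) \<longleftrightarrow> sat (\<lambda>n. val_tm e (\<sigma> n)) A"
  by (induction A arbitrary: e \<sigma>) (simp_all add: val_subst_tm val_under)

lemma sat_lift [simp]: "sat (case_nat n e) (lift A) \<longleftrightarrow> sat e A"
  by (simp add: lift_def sat_subst)

lemma sat_inst: "sat e (inst A t) \<longleftrightarrow> sat (case_nat (val_tm e t) e) A"
proof -
  have "(\<lambda>n. val_tm e (case_nat t AVar n)) = case_nat (val_tm e t) e"
    by (auto split: nat.split)
  then show ?thesis by (simp add: inst_def sat_subst)
qed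

lemma val_num [simp]: "val_tm e (num n) = n"
  by (induction n) auto

lemma aprop_sat: "aprop (sat e) A \<longleftrightarrow> sat e A"
  by (induction A) auto

theorem PA_sound: "PA\<turnstile> A \<Longrightarrow> sat e A"
proof (induction arbitrary: e rule: PA.induct)
  case (Taut A)
  then show ?case by (metis ataut_def aprop_sat)
next
  case (Ind A)
  \<comment> \<open>Putting the successor for variable 0 means evaluating at \<open>Suc n\<close>,
    so the axiom turns into induction on the natural numbers.\<close>
  have shift: "(\<lambda>k. val_tm (case_nat n e) (case_nat (ASucc (AVar 0)) (\<lambda>n. AVar (Suc n)) k)) =
      case_nat (Suc n) e" for n
    by (auto split: nat.split)
  show ?case
  proof (simp add: sat_inst sat_subst shift, intro impI allI)
    fix n
    assume "sat (case_nat 0 e) A"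
      and "\<forall>n. sat (case_nat n e) A \<longrightarrow> sat (case_nat (Suc n) e) A"
    then show "sat (case_nat n e) A" by (induction n) auto
  qed
qed (auto simp: sat_inst)

section \<open>Derived rules of Peano arithmetic\<close>

text \<open>Substitution sends atoms to atoms, so a valuation pulls back along it and instances of
  tautologies stay tautologies.\<close>

lemma aprop_subst: "aprop v (subst \<sigma> A) \<longleftrightarrow> aprop (\<lambda>B. aprop v (subst \<sigma> B)) A"
  by (induction A) auto

lemma PA_taut1: "PA\<turnstile> A \<Longrightarrow> ataut (AImp A B) \<Longrightarrow> PA\<turnstile> B"
  by (metis PA.Taut PA.MP)

lemma PA_taut2: "PA\<turnstile> A \<Longrightarrow> PA\<turnstile> B \<Longrightarrow> ataut (AImp A (AImp B C)) \<Longrightarrow> PA\<turnstile> C"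
  by (metis PA.Taut PA.MP)

lemma PA_imp_trans: "PA\<turnstile> AImp A B \<Longrightarrow> PA\<turnstile> AImp B C \<Longrightarrow> PA\<turnstile> AImp A C"
  by (erule PA_taut2) (auto simp: ataut_def)

lemma PA_spec: "PA\<turnstile> AAll A \<Longrightarrow> PA\<turnstile> inst A t"
  by (metis PA.AllE PA.MP)

text \<open>The arithmetical axioms are formulas in the variables \<open>0\<close> and \<open>1\<close>; their substitution
  instances are obtained by specializing their closures.\<close>

lemma PA_subst_two_vars:
  assumes A: "PA\<turnstile> A" and fv: "fv A \<subseteq> {0, 1}"
  shows "PA\<turnstile> subst \<sigma> A"
proof -
  \<comment> \<open>The outer of the two generalizations binds variable 1, so its value is supplied
    first.\<close>
  define \<tau> where "\<tau> = case_nat (\<sigma> 1) AVar"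
  have "PA\<turnstile> inst (AAll A) (\<sigma> 1)"
    by (intro PA_spec PA.Gen A)
  then have "PA\<turnstile> inst (subst (under \<tau>) A) (\<sigma> 0)"
    by (intro PA_spec) (simp add: inst_def \<tau>_def)
  also have "inst (subst (under \<tau>) A) (\<sigma> 0) = subst \<sigma> A"
    unfolding inst_subst_under by (rule subst_cong) (use fv in \<open>auto simp: \<tau>_def\<close>)
  finally show ?thesis .
qed

text \<open>The schemes are stable because substitution commutes with \<open>inst\<close> and
  \<open>lift\<close>. \<open>Gen\<close> needs the hypothesis at \<open>under \<sigma>\<close>,
  hence the arbitrary \<sigma>.\<close>

theorem PA_subst: "PA\<turnstile> A \<Longrightarrow> PA\<turnstile> subst \<sigma> A"
proof (induction arbitrary: \<sigma> rule: PA.induct)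
  case (Taut A)
  then have "ataut (subst \<sigma> A)" unfolding ataut_def by (subst aprop_subst) blast
  then show ?case by (rule PA.Taut)
next
  case (AllE A t)
  show ?case by (simp add: subst_inst PA.AllE)
next
  case (AllImp A B)
  show ?case by (simp add: PA.AllImp)
next
  case (AllVac A)
  have "subst (under \<sigma>) (lift A) = lift (subst \<sigma> A)"
    by (simp add: subst_lift lift_subst)
  then show ?case by (simp add: PA.AllVac)
next
  case (ExI A t)
  show ?case by (simp add: subst_inst PA.ExI)
next
  case (ExE A B)
  have "subst (under \<sigma>) (lift B) = lift (subst \<sigma> B)"
    by (simp add: subst_lift lift_subst)
  then show ?case by (simp add: PA.ExE)
next
  case (EqSubst s t A)
  show ?case by (simp add: subst_inst PA.EqSubst)
next
  case (Ind A)
  let ?s = "case_nat (ASucc (AVar 0)) (\<lambda>n. AVar (Suc n))"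
  \<comment> \<open>The shift \<open>?s\<close> puts a successor only on variable 0, which
    \<open>under \<sigma>\<close> fixes, so the two substitutions commute.\<close>
  have "subst_tm (under \<sigma>) (?s n) = subst_tm ?s (under \<sigma> n)" for n
    by (cases n) (simp_all add: subst_tm_lift_tm, simp add: lift_tm_def)
  then have "subst (under \<sigma>) (subst ?s A) = subst ?s (subst (under \<sigma>) A)"
    by (simp add: subst_comp)
  then show ?case using PA.Ind[of "subst (under \<sigma>) A"] by (simp add: subst_inst)
next
  case (MP A B)
  show ?case using MP.IH(1)[of \<sigma>, unfolded subst.simps] MP.IH(2) by (rule PA.MP)
next
  case (Gen A)
  then show ?case by (simp add: PA.Gen)
qed (simp add: PA.EqRefl,
  (rule PA_subst_two_vars,
    rule PA.SuccNotZero PA.SuccInj PA.PlusZero PA.PlusSucc PA.TimesZero PA.TimesSucc, simp)+)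

text \<open>Shifting the parameters up first compensates for their lowering by \<open>inst\<close>,
  so the instance at variable 0 is \<open>A\<close> itself.\<close>

lemma PA_unGen:
  assumes "PA\<turnstile> AAll A"
  shows "PA\<turnstile> A"
proof -
  have "PA\<turnstile> inst (subst (under (\<lambda>n. AVar (Suc n))) A) (AVar 0)"
    using PA_subst[OF assms] by (intro PA_spec) simp
  moreover have "case_nat (AVar 0) (\<lambda>n. AVar (Suc n)) = AVar"
    by (auto split: nat.split)
  ultimately show ?thesis by (simp add: inst_subst_under)
qed

lemma PA_ex_imp: "PA\<turnstile> AImp A (lift B) \<Longrightarrow> PA\<turnstile> AImp (AEx A) B"
  by (metis PA.ExE PA.MP PA.Gen)

lemma PA_exI: "PA\<turnstile> inst A t \<Longrightarrow> PA\<turnstile> AEx A"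
  by (metis PA.ExI PA.MP)

section \<open>Equality reasoning in PA\<close>

lemma PA_eq_sym: "PA\<turnstile> AImp (AEq s t) (AEq t s)"
  using PA.EqSubst[of s t "AEq (AVar 0) (lift_tm s)"] PA.EqRefl[of s]
  by (rule PA_taut2) (auto simp: ataut_def inst_def subst_tm_lift_tm)

lemma PA_eq_trans: "PA\<turnstile> AImp (AEq s t) (AImp (AEq t u) (AEq s u))"
  using PA.EqSubst[of t u "AEq (lift_tm s) (AVar 0)"]
  by (rule PA_taut1) (auto simp: ataut_def inst_def subst_tm_lift_tm)

lemma PA_eq_symI: "PA\<turnstile> AEq s t \<Longrightarrow> PA\<turnstile> AEq t s"
  by (metis PA_eq_sym PA.MP)

lemma PA_eq_transI: "PA\<turnstile> AEq s t \<Longrightarrow> PA\<turnstile> AEq t u \<Longrightarrow> PA\<turnstile> AEq s u"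
  by (metis PA_eq_trans PA.MP)

text \<open>\<open>u\<close> has its hole at variable 0; the equality scheme is applied to
  \<open>?A\<close>, whose left side is lifted so as to stay fixed.\<close>

lemma PA_eq_cong:
  assumes "PA\<turnstile> AEq s t"
  shows "PA\<turnstile> AEq (subst_tm (case_nat s AVar) u) (subst_tm (case_nat t AVar) u)"
proof -
  let ?A = "AEq (lift_tm (subst_tm (case_nat s AVar) u)) u"
  have "PA\<turnstile> inst ?A s"
    by (simp add: inst_def subst_tm_lift_tm PA.EqRefl)
  then have "PA\<turnstile> inst ?A t" by (rule PA.MP[OF PA.MP[OF PA.EqSubst assms]])
  then show ?thesis by (simp add: inst_def subst_tm_lift_tm)
qed

lemma PA_eq_Succ: "PA\<turnstile> AEq s t \<Longrightarrow> PA\<turnstile> AEq (ASucc s) (ASucc t)"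
  using PA_eq_cong[of s t "ASucc (AVar 0)"] by simp

lemma PA_eq_Plus:
  assumes "PA\<turnstile> AEq s s'" "PA\<turnstile> AEq t t'"
  shows "PA\<turnstile> AEq (APlus s t) (APlus s' t')"
  using PA_eq_cong[OF assms(1), of "APlus (AVar 0) (lift_tm t)"]
    PA_eq_cong[OF assms(2), of "APlus (lift_tm s') (AVar 0)"]
  by (simp add: subst_tm_lift_tm PA_eq_transI)

lemma PA_eq_Times:
  assumes "PA\<turnstile> AEq s s'" "PA\<turnstile> AEq t t'"
  shows "PA\<turnstile> AEq (ATimes s t) (ATimes s' t')"
  using PA_eq_cong[OF assms(1), of "ATimes (AVar 0) (lift_tm t)"]
    PA_eq_cong[OF assms(2), of "ATimes (lift_tm s') (AVar 0)"]
  by (simp add: subst_tm_lift_tm PA_eq_transI)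

section \<open>Arithmetical axioms at arbitrary terms\<close>

lemma PA_Succ_neq_Zero: "PA\<turnstile> ANeg (AEq (ASucc s) AZero)"
  using PA_subst[OF PA.SuccNotZero, of "\<lambda>_. s"] by simp

lemma PA_Succ_inj: "PA\<turnstile> AImp (AEq (ASucc s) (ASucc t)) (AEq s t)"
  using PA_subst[OF PA.SuccInj, of "case_nat s (\<lambda>_. t)"] by simp

lemma PA_Plus_Zero: "PA\<turnstile> AEq (APlus s AZero) s"
  using PA_subst[OF PA.PlusZero, of "\<lambda>_. s"] by simp

lemma PA_Plus_Succ: "PA\<turnstile> AEq (APlus s (ASucc t)) (ASucc (APlus s t))"
  using PA_subst[OF PA.PlusSucc, of "case_nat s (\<lambda>_. t)"] by simp

lemma PA_Times_Zero: "PA\<turnstile> AEq (ATimes s AZero) AZero"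
  using PA_subst[OF PA.TimesZero, of "\<lambda>_. s"] by simp

lemma PA_Times_Succ: "PA\<turnstile> AEq (ATimes s (ASucc t)) (APlus (ATimes s t) s)"
  using PA_subst[OF PA.TimesSucc, of "case_nat s (\<lambda>_. t)"] by simp

section \<open>Sigma-completeness\<close>

lemma PA_num_plus: "PA\<turnstile> AEq (APlus (num m) (num n)) (num (m + n))"
proof (induction n)
  case 0
  show ?case by (simp add: PA_Plus_Zero)
next
  case (Suc n)
  show ?case using PA_eq_transI[OF PA_Plus_Succ PA_eq_Succ[OF Suc]] by simp
qed

lemma PA_num_times: "PA\<turnstile> AEq (ATimes (num m) (num n)) (num (m * n))"
proof (induction n)
  case 0
  show ?case by (simp add: PA_Times_Zero)
next
  case (Suc n)
  show ?case
    using PA_eq_transI[OF PA_Times_Succ PA_eq_transI[OF PA_eq_Plus[OF Suc PA.EqRefl] PA_num_plus]]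
    by (simp add: add.commute)
qed

lemma PA_eval: "PA\<turnstile> AEq (subst_tm (\<lambda>n. num (e n)) t) (num (val_tm e t))"
proof (induction t)
  case (APlus s t)
  then show ?case using PA_eq_transI[OF PA_eq_Plus PA_num_plus] by simp
next
  case (ATimes s t)
  then show ?case using PA_eq_transI[OF PA_eq_Times PA_num_times] by simp
qed (simp_all add: PA.EqRefl PA_eq_Succ)

lemma PA_num_neq: "m \<noteq> n \<Longrightarrow> PA\<turnstile> ANeg (AEq (num m) (num n))"
proof (induction m arbitrary: n)
  case 0
  then obtain k where n: "n = Suc k" by (cases n) auto
  from PA_Succ_neq_Zero[of "num k"] PA_eq_sym[of AZero "ASucc (num k)"] show ?case
    unfolding n by (rule PA_taut2) (auto simp: ataut_def)
next
  case (Suc m)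
  show ?case
  proof (cases n)
    case 0
    then show ?thesis by (simp add: PA_Succ_neq_Zero)
  next
    case (Suc k)
    then have "PA\<turnstile> ANeg (AEq (num m) (num k))" using Suc.IH Suc.prems by simp
    with PA_Succ_inj[of "num m" "num k"] show ?thesis
      unfolding Suc by (rule PA_taut2) (auto simp: ataut_def)
  qed
qed

lemma PA_decides_eq:
  fixes s t e
  defines "A \<equiv> subst (\<lambda>n. num (e n)) (AEq s t)"
  shows "sat e (AEq s t) \<Longrightarrow> PA\<turnstile> A"
    and "\<not> sat e (AEq s t) \<Longrightarrow> PA\<turnstile> ANeg A"
proof -
  let ?s = "subst_tm (\<lambda>n. num (e n)) s" and ?t = "subst_tm (\<lambda>n. num (e n)) t"
  have s: "PA\<turnstile> AEq ?s (num (val_tm e s))" and t: "PA\<turnstile> AEq ?t (num (val_tm e t))"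
    by (rule PA_eval)+
  {
    assume "sat e (AEq s t)"
    then show "PA\<turnstile> A" using PA_eq_transI[OF s] PA_eq_symI[OF t] by (simp add: A_def)
  next
    assume "\<not> sat e (AEq s t)"
    then have neq: "PA\<turnstile> ANeg (AEq (num (val_tm e s)) (num (val_tm e t)))"
      by (simp add: PA_num_neq)
    \<comment> \<open>Equality of the terms, chained through their values, would equate two distinct
      numerals.\<close>
    have "PA\<turnstile> AImp (AEq ?s ?t) (AEq (num (val_tm e s)) ?t)"
      using PA_eq_trans by (rule PA.MP) (rule PA_eq_symI[OF s])
    moreover have "PA\<turnstile> AImp (AEq (num (val_tm e s)) ?t) (AEq (num (val_tm e s)) (num (val_tm e t)))"
      using PA_eq_trans[of "num (val_tm e s)" ?t "num (val_tm e t)"] t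
      by (rule PA_taut2) (auto simp: ataut_def)
    ultimately show "PA\<turnstile> ANeg A"
      using neq unfolding A_def subst.simps by (rule PA_imp_trans[OF PA_imp_trans])
  }
qed

section \<open>Quantification below a numeral\<close>

lemma PA_eq_subst_var:
  assumes "PA\<turnstile> inst A (num n)"
  shows "PA\<turnstile> AImp (AEq (AVar 0) (num n)) A"
proof -
  \<comment> \<open>Parameters are shifted past variable 0: at \<open>AVar 0\<close> this gives back
    \<open>A\<close>, at a numeral the shifted instance of \<open>A\<close>.\<close>
  define D where "D = subst (under (\<lambda>n. AVar (Suc n))) A"
  have "case_nat (AVar 0) (\<lambda>n. AVar (Suc n)) = AVar"
    by (auto split: nat.split)
  then have D0: "inst D (AVar 0) = A"
    by (simp add: D_def inst_subst_under)
  have "inst D (num n) = subst (\<lambda>n. AVar (Suc n)) (inst A (num n))"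
    by (simp add: D_def subst_inst)
  then have Dn: "PA\<turnstile> inst D (num n)"
    using PA_subst[OF assms] by simp
  have "PA\<turnstile> AImp (AEq (num n) (AVar 0)) A"
    using PA.EqSubst[of "num n" "AVar 0" D] Dn unfolding D0
    by (rule PA_taut2) (auto simp: ataut_def)
  with PA_eq_sym show ?thesis by (rule PA_imp_trans)
qed

text \<open>Case distinction on the difference \<open>z\<close> in \<open>x + z = n\<close>: either \<open>z\<close> is \<open>0\<close> and \<open>x\<close> is \<open>n\<close>, or
  \<open>z\<close> is a successor and \<open>x < n\<close>. The induction axiom is used only for this distinction.\<close>

lemma PA_less_num_open:
  assumes "\<And>k. k < n \<Longrightarrow> PA\<turnstile> inst A (num k)"
  shows "PA\<turnstile> AImp (AEq (APlus (AVar 1) (ASucc (AVar 0))) (num n)) (lift A)"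
  using assms
proof (induction n)
  case 0
  let ?t = "APlus (AVar 1) (ASucc (AVar 0))" and ?u = "ASucc (APlus (AVar 1) (AVar 0))"
  have "PA\<turnstile> AImp (AEq ?t AZero) (AEq ?u AZero)"
    using PA_eq_trans PA_eq_symI[OF PA_Plus_Succ] by (rule PA.MP)
  then show ?case using PA_Succ_neq_Zero[of "APlus (AVar 1) (AVar 0)"]
    by (rule PA_taut2) (auto simp: ataut_def)
next
  case (Suc n)
  \<comment> \<open>Variable 0 is now z and x sits at index 1, which is why \<open>A\<close> is
    lifted.\<close>
  define B where "B = AImp (AEq (APlus (AVar 1) (AVar 0)) (num n)) (lift A)"
  \<comment> \<open>The case z = 0 forces x = n, the one index below \<open>Suc n\<close> that is
    not below \<open>n\<close>.\<close>
  have "PA\<turnstile> AImp (AEq (APlus (AVar 0) AZero) (num n)) (AEq (AVar 0) (num n))"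
    using PA_eq_trans PA_eq_symI[OF PA_Plus_Zero] by (rule PA.MP)
  then have "PA\<turnstile> AImp (AEq (APlus (AVar 0) AZero) (num n)) A"
    by (rule PA_imp_trans) (simp add: PA_eq_subst_var Suc.prems)
  then have base: "PA\<turnstile> inst B AZero"
    using inst_lift[of A AZero] by (simp add: B_def inst_def)
  \<comment> \<open>The outer induction hypothesis is exactly \<open>B\<close> at the successor of z
    and so supplies the step of \<open>PA.Ind\<close>.\<close>
  have "PA\<turnstile> AImp (AEq (APlus (AVar 1) (ASucc (AVar 0))) (num n)) (lift A)"
    using Suc by simp
  then have "PA\<turnstile> subst (case_nat (ASucc (AVar 0)) (\<lambda>n. AVar (Suc n))) B"
    unfolding B_def by (simp add: subst_lift) (simp add: lift_def)
  then have "PA\<turnstile> AAll (AImp B (subst (case_nat (ASucc (AVar 0)) (\<lambda>n. AVar (Suc n))) B))"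
    by (intro PA.Gen, rule PA_taut1) (auto simp: ataut_def)
  then have "PA\<turnstile> AAll B" by (rule PA.MP[OF PA.MP[OF PA.Ind base]])
  then have B: "PA\<turnstile> B" by (rule PA_unGen)
  have "PA\<turnstile> AImp (AEq (APlus (AVar 1) (ASucc (AVar 0))) (num (Suc n)))
              (AEq (ASucc (APlus (AVar 1) (AVar 0))) (num (Suc n)))"
    using PA_eq_trans PA_eq_symI[OF PA_Plus_Succ] by (rule PA.MP)
  moreover have "PA\<turnstile> AImp (AEq (ASucc (APlus (AVar 1) (AVar 0))) (num (Suc n)))
                       (AEq (APlus (AVar 1) (AVar 0)) (num n))"
    using PA_Succ_inj by simp
  ultimately show ?case using B unfolding B_def by (rule PA_imp_trans[OF PA_imp_trans])
qed

lemma subst_ALess_lift: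
  "subst (under \<sigma>) (ALess (AVar 0) (lift_tm t)) = ALess (AVar 0) (lift_tm (subst_tm \<sigma> t))"
  by (simp add: ALess_def subst_tm_lift_tm lift_tm_subst_tm)

text \<open>The equality scheme replaces the bound by its numeral value; below a numeral, finitely
  many instances suffice.\<close>

lemma PA_all_less:
  assumes "PA\<turnstile> AEq t (num n)" and "\<And>k. k < n \<Longrightarrow> PA\<turnstile> inst A (num k)"
  shows "PA\<turnstile> AAll (AImp (ALess (AVar 0) (lift_tm t)) A)"
proof -
  have inst_less: "inst (ALess (AVar 1) (AVar 0)) u = ALess (AVar 0) u" for u
    by (simp add: inst_def ALess_def subst_tm_lift_tm)
  have "PA\<turnstile> AEq (lift_tm t) (num n)"
    using PA_subst[OF assms(1), of "\<lambda>n. AVar (Suc n)"] by (simp add: lift_tm_def)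
  then have "PA\<turnstile> AImp (ALess (AVar 0) (lift_tm t)) (ALess (AVar 0) (num n))"
    using PA.EqSubst[of "lift_tm t" "num n" "ALess (AVar 1) (AVar 0)"] unfolding inst_less
    by (metis PA.MP)
  moreover have "PA\<turnstile> AImp (ALess (AVar 0) (num n)) A"
    using PA_ex_imp[OF PA_less_num_open[OF assms(2)]]
    by (simp add: ALess_def lift_tm_def)
  ultimately show ?thesis by (intro PA.Gen) (rule PA_imp_trans)
qed

section \<open>Decision of bounded formulas at numerals\<close>

lemma inst_subst_num:
  "inst (subst (under (\<lambda>i. num (e i))) A) (num n) = subst (\<lambda>i. num (case_nat n e i)) A"
proof -
  have "case_nat (num n) (\<lambda>i. num (e i)) = (\<lambda>i. num (case_nat n e i))"
    by (auto split: nat.split)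
  then show ?thesis by (simp add: inst_subst_under)
qed

lemma sat_ALess: "sat e (ALess s t) \<longleftrightarrow> val_tm e s < val_tm e t"
proof -
  have "val_tm (case_nat n e) (lift_tm u) = val_tm e u" for n u
    by (simp add: lift_tm_def val_subst_tm)
  then show ?thesis by (simp add: ALess_def less_iff_Suc_add eq_commute)
qed

lemma PA_ALess:
  assumes "sat e (ALess s t)"
  shows "PA\<turnstile> subst (\<lambda>i. num (e i)) (ALess s t)"
proof -
  from assms obtain n where
    "sat (case_nat n e) (AEq (APlus (lift_tm s) (ASucc (AVar 0))) (lift_tm t))"
    unfolding ALess_def by auto
  then show ?thesis
    unfolding ALess_def subst.simps(7)
    by (intro PA_exI[of _ "num n"]) (simp only: inst_subst_num PA_decides_eq)
qed

text \<open>Provability and refutability are proved together because implication exchanges them.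
  Witnesses and counterexamples use \<open>PA_ALess\<close>; true universals and false existentials
  use \<open>PA_all_less\<close>.\<close>

theorem PA_decides_bounded:
  assumes "bounded_fm A"
  shows "PA\<turnstile> (if sat e A then subst (\<lambda>i. num (e i)) A else ANeg (subst (\<lambda>i. num (e i)) A))"
  using assms
proof (induction arbitrary: e rule: bounded_fm.induct)
  case (1 s t)
  show ?case by (simp del: sat.simps subst.simps add: PA_decides_eq)
next
  case 2
  show ?case by (auto simp: ataut_def intro: PA.Taut)
next
  case (3 A B)
  show ?case using "3.IH"[of e] by (rule PA_taut2) (auto simp: ataut_def)
next
  case (4 A B)
  show ?case using "4.IH"[of e] by (rule PA_taut2) (auto simp: ataut_def)
next
  case (5 A B)
  show ?case using "5.IH"[of e] by (rule PA_taut2) (auto simp: ataut_def)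
next
  case (6 A t)
  let ?A = "subst (under (\<lambda>i. num (e i))) A"
  let ?L = "ALess (AVar 0) (lift_tm t)"
  let ?L' = "ALess (AVar 0) (lift_tm (subst_tm (\<lambda>i. num (e i)) t))"
  have L: "sat (case_nat k e) ?L \<longleftrightarrow> k < val_tm e t" for k
    by (simp add: sat_ALess lift_tm_def val_subst_tm)
  have eq: "subst (\<lambda>i. num (e i)) (AAll (AImp ?L A)) = AAll (AImp ?L' ?A)"
    by (simp add: subst_ALess_lift)
  show ?case
  proof (cases "sat e (AAll (AImp ?L A))")
    case True
    then have "PA\<turnstile> inst ?A (num k)" if "k < val_tm e t" for k
      using that "6.IH"[of "case_nat k e"] L by (simp add: inst_subst_num)
    then have "PA\<turnstile> subst (\<lambda>i. num (e i)) (AAll (AImp ?L A))"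
      unfolding eq by (rule PA_all_less[OF PA_eval])
    with True show ?thesis by (simp only: if_True)
  next
    case False
    then obtain k where k: "sat (case_nat k e) ?L" "\<not> sat (case_nat k e) A" by auto
    have "PA\<turnstile> AImp (subst (\<lambda>i. num (e i)) (AAll (AImp ?L A)))
              (subst (\<lambda>i. num (case_nat k e i)) (AImp ?L A))"
      unfolding inst_subst_num[symmetric] subst.simps(6) by (rule PA.AllE)
    moreover have "PA\<turnstile> ANeg (subst (\<lambda>i. num (case_nat k e i)) (AImp ?L A))"
      using PA_ALess[OF k(1)] "6.IH"[of "case_nat k e"]
      by (rule PA_taut2) (use k(2) in \<open>auto simp: ataut_def\<close>)
    ultimately have "PA\<turnstile> ANeg (subst (\<lambda>i. num (e i)) (AAll (AImp ?L A)))"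
      by (rule PA_imp_trans)
    with False show ?thesis by (simp only: if_False)
  qed
next
  case (7 A t)
  let ?A = "subst (under (\<lambda>i. num (e i))) A"
  let ?L = "ALess (AVar 0) (lift_tm t)"
  let ?L' = "ALess (AVar 0) (lift_tm (subst_tm (\<lambda>i. num (e i)) t))"
  have L: "sat (case_nat k e) ?L \<longleftrightarrow> k < val_tm e t" for k
    by (simp add: sat_ALess lift_tm_def val_subst_tm)
  have eq: "subst (\<lambda>i. num (e i)) (AEx (AConj ?L A)) = AEx (AConj ?L' ?A)"
    by (simp add: subst_ALess_lift)
  show ?case
  proof (cases "sat e (AEx (AConj ?L A))")
    case True
    then obtain k where k: "sat (case_nat k e) ?L" "sat (case_nat k e) A" by auto
    have "PA\<turnstile> subst (\<lambda>i. num (case_nat k e i)) (AConj ?L A)"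
      using PA_ALess[OF k(1)] "7.IH"[of "case_nat k e"]
      by (rule PA_taut2) (use k(2) in \<open>auto simp: ataut_def\<close>)
    then have "PA\<turnstile> subst (\<lambda>i. num (e i)) (AEx (AConj ?L A))"
      unfolding inst_subst_num[symmetric] subst.simps(7) by (rule PA_exI)
    with True show ?thesis by (simp only: if_True)
  next
    case False
    \<comment> \<open>A false bounded existential is refuted through the bounded universal of the
      negated body.\<close>
    then have "PA\<turnstile> inst (ANeg ?A) (num k)" if "k < val_tm e t" for k
      using that "7.IH"[of "case_nat k e"] L inst_subst_num[of e A k] by (simp add: inst_def)
    then have "PA\<turnstile> AAll (AImp ?L' (ANeg ?A))"
      by (rule PA_all_less[OF PA_eval])
    then have "PA\<turnstile> AImp (AConj ?L' ?A) (lift AFalse)"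
      by (rule PA_taut1[OF PA_unGen]) (auto simp: ataut_def lift_def)
    then have "PA\<turnstile> ANeg (subst (\<lambda>i. num (e i)) (AEx (AConj ?L A)))"
      unfolding eq by (rule PA_ex_imp)
    with False show ?thesis by (simp only: if_False)
  qed
qed

section \<open>Existential prefixes and provably \<Sigma> formulas\<close>

theorem PA_sigma_complete: "sigma_fm A \<Longrightarrow> sat e A \<Longrightarrow> PA\<turnstile> subst (\<lambda>i. num (e i)) A"
proof (induction arbitrary: e rule: sigma_fm.induct)
  case (1 A)
  then show ?case using PA_decides_bounded[of A e] by simp
next
  case (2 A)
  then obtain k where "PA\<turnstile> inst (subst (under (\<lambda>i. num (e i))) A) (num k)"
    by (auto simp: inst_subst_num)
  then show ?case using PA_exI by simp
qed

text \<open>Soundness of PA carries truth over to the \<Sigma> equivalent; provability returns along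
  the substituted equivalence.\<close>

lemma PA_provably_sigma_complete:
  assumes "provably_sigma A" and "sat e A"
  shows "PA\<turnstile> subst (\<lambda>i. num (e i)) A"
proof -
  from assms(1) obtain B where B: "sigma_fm B" "PA\<turnstile> AIff A B"
    unfolding provably_sigma_def by blast
  have "sat e B" using PA_sound[OF B(2), of e] assms(2) by simp
  with B(1) have "PA\<turnstile> subst (\<lambda>i. num (e i)) B" by (rule PA_sigma_complete)
  with PA_subst[OF B(2)] show ?thesis
    by (rule PA_taut2) (auto simp: ataut_def)
qed

section \<open>Soundness of LPV\<close>

text \<open>Both \<open>P\<close> and its negation are provably \<Sigma>, so whichever is true at
  the given numerals is provable there.\<close>

lemma Prf_of_decided:
  assumes "normal_proof_predicate P"
  shows "proves P k F \<Longrightarrow> PA\<turnstile> Prf_of P k F"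
    and "\<not> proves P k F \<Longrightarrow> PA\<turnstile> ANeg (Prf_of P k F)"
proof -
  define u where "u e = case_nat k (case_nat (gn F) e)" for e :: "nat \<Rightarrow> nat"
  have "fv P \<subseteq> {0, 1}" and "provably_delta P"
    using assms by (auto simp: normal_proof_predicate_def)
  then have sigma: "provably_sigma P" "provably_sigma (ANeg P)"
    by (auto simp: provably_delta_def)
  have eq: "subst (\<lambda>i. num (u e i)) P = Prf_of P k F" for e
    unfolding Prf_of_def by (rule subst_cong) (use \<open>fv P \<subseteq> {0, 1}\<close> in \<open>auto simp: u_def\<close>)
  have "(\<lambda>i. val_tm e (case_nat (num k) (case_nat (num (gn F)) AVar) i)) = u e" for e
    by (auto simp: u_def split: nat.split)
  then have sat: "sat e (Prf_of P k F) \<longleftrightarrow> sat (u e) P" for e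
    by (simp add: Prf_of_def sat_subst)
  show "PA\<turnstile> Prf_of P k F" if "proves P k F"
    using that PA_provably_sigma_complete[OF sigma(1), of "u (\<lambda>_. 0)"] sat eq
    by (auto simp: true_arith_def)
  show "PA\<turnstile> ANeg (Prf_of P k F)" if "\<not> proves P k F"
  proof -
    \<comment> \<open>Failure of \<open>true_arith\<close> yields only some falsifying assignment;
      by \<open>eq\<close> each assignment leads to the same closed instance.\<close>
    from that obtain e where "sat (u e) (ANeg P)" by (auto simp: true_arith_def sat)
    then show ?thesis using PA_provably_sigma_complete[OF sigma(2)] eq by force
  qed
qed

lemma sentence_Prf_of: "fv P \<subseteq> {0, 1} \<Longrightarrow> sentence (Prf_of P k F)"
  by (force simp: sentence_def Prf_of_def fv_subst)

lemma sentence_Ver_of: "fv V \<subseteq> {0} \<Longrightarrow> sentence (Ver_of V F)"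
  by (force simp: sentence_def Ver_of_def inst_def fv_subst)

text \<open>Normality and the laws of the proof operations speak of sentences; this makes them
  applicable to interpreted formulas.\<close>

lemma sentence_fm_interp:
  assumes "arithmetical_interpretation I"
  shows "sentence (fm_interp I F)"
proof (induction F)
  case (Ver F)
  then show ?case using assms
    by (simp add: arithmetical_interpretation_def verification_predicate_def sentence_Ver_of)
next
  case (Just t F)
  then show ?case using assms
    by (simp add: arithmetical_interpretation_def normal_proof_predicate_def sentence_Prf_of)
qed (use assms in \<open>auto simp: arithmetical_interpretation_def sentence_def\<close>)

text \<open>Arithmetical valuations pull back along the interpretation, so tautologies of the logic
  become arithmetical tautologies.\<close>

lemma fprop_fm_interp:
  "fprop (\<lambda>B. aprop v (fm_interp I B)) A \<longleftrightarrow> aprop v (fm_interp I A)"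
  by (induction A) auto

lemma PA_LPV_axiom:
  assumes I: "arithmetical_interpretation I" and "LPV_axiom F"
  shows "PA\<turnstile> fm_interp I F"
proof -
  define P where "P = prf_fm I"
  have normal: "normal_proof_predicate P"
    and ops: "proof_operations P (m_fun I) (a_fun I) (c_fun I)"
    and ver: "verification_predicate P (ver_fm I)"
    using I by (auto simp: arithmetical_interpretation_def P_def)
  have Just: "fm_interp I (Just t A) = Prf_of P (tm_interp I t) (fm_interp I A)" for t A
    by (simp add: P_def)
  note sent = sentence_fm_interp[OF I]
  \<comment> \<open>A false proof statement is refutable and implies everything, so \<open>B\<close>
    has to be proved only when the statement is true.\<close>
  have decided_imp: "PA\<turnstile> AImp (Prf_of P k A) B" if "proves P k A \<Longrightarrow> PA\<turnstile> B" for k A B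
  proof (cases "proves P k A")
    case True
    with that have "PA\<turnstile> B" by blast
    then show ?thesis by (rule PA_taut1) (auto simp: ataut_def)
  next
    case False
    then have "PA\<turnstile> ANeg (Prf_of P k A)" using Prf_of_decided(2)[OF normal] by blast
    then show ?thesis by (rule PA_taut1) (auto simp: ataut_def)
  qed
  have imp: "PA\<turnstile> AImp (Prf_of P k A) (Prf_of P l B)" if "proves P k A \<Longrightarrow> proves P l B" for k l A B
    using that decided_imp Prf_of_decided(1)[OF normal] by blast
  show ?thesis using assms(2)
  proof cases
    case 1
    then have "ataut (fm_interp I F)"
      unfolding tautology_def ataut_def by (subst fprop_fm_interp[symmetric]) blast
    then show ?thesis by (rule PA.Taut)
  next
    case (2 t A B s)
    \<comment> \<open>\<open>decided_imp\<close> disposes of the premise on \<open>t\<close> and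
      \<open>imp\<close> of the one on \<open>s\<close>, leaving the law of \<open>m_fun\<close> in
      the standard model.\<close>
    show ?thesis unfolding 2 fm_interp.simps(5) Just tm_interp.simps
      by (rule decided_imp, rule imp)
        (use ops sent[of A] sent[of B] in \<open>unfold proof_operations_def, blast\<close>)
  next
    case (3 t A)
    \<comment> \<open>Reflection: if the number really proves the sentence, normality yields a PA
      derivation of it.\<close>
    show ?thesis unfolding 3 fm_interp.simps(5) Just
      by (rule decided_imp) (use normal sent in \<open>auto simp: normal_proof_predicate_def\<close>)
  next
    case (4 t A)
    show ?thesis unfolding 4 fm_interp.simps(5) Just tm_interp.simps
      by (intro imp) (use ops sent in \<open>auto simp: proof_operations_def\<close>)
  next
    case (5 t A s)
    show ?thesis unfolding 5 fm_interp.simps(5) Just tm_interp.simps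
      by (intro imp) (use ops sent in \<open>auto simp: proof_operations_def\<close>)
  next
    case (6 t A s)
    show ?thesis unfolding 6 fm_interp.simps(5) Just tm_interp.simps
      by (intro imp) (use ops sent in \<open>auto simp: proof_operations_def\<close>)
  next
    \<comment> \<open>The last three axioms become literal instances of the conditions in
      \<open>verification_predicate\<close>.\<close>
    case 7
    then show ?thesis using ver by (simp add: verification_predicate_def)
  next
    case 8
    then show ?thesis using ver by (simp add: verification_predicate_def P_def)
  next
    case 9
    then show ?thesis using ver by (simp add: verification_predicate_def P_def)
  qed
qed

theorem theorem4:
  fixes CS :: "fm set" and F :: fm
  assumes "constant_specification CS"
    and "LPV-CS \<turnstile> F"
  shows "provably_valid CS F"
  unfolding provably_valid_def
proof (intro allI impI)
  fix I assume CS: "CS_interpretation CS I"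
  then have I: "arithmetical_interpretation I"
    and true: "\<And>G. G \<in> CS \<Longrightarrow> true_arith (fm_interp I G)"
    by (auto simp: CS_interpretation_def)
  from assms(2) show "PA\<turnstile> fm_interp I F"
  proof induction
    case (1 A)
    then show ?case by (rule PA_LPV_axiom[OF I])
  next
    case (2 A)
    \<comment> \<open>Members of \<open>CS\<close> are only known to be true; being proof
      statements, they are decided by PA and hence provable.\<close>
    then obtain i B where "A = Just (PConst i) B"
      using assms(1) unfolding constant_specification_def by blast
    then show ?case
      using true[OF 2] I Prf_of_decided(1) by (simp add: arithmetical_interpretation_def)
  next
    case (3 A B)
    then show ?case by (metis PA.MP fm_interp.simps(5))
  qed
qed

end
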